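(* For all $n\ge 2$, \[\left|\mathrm{Av}_n[\overline{23}14]\right|=\sum_{i=0}^{n-2}\binom{n-2}{i}A_i,\] where $A_i$ is the number of strongly monotone partitions of $[i]$ (with $A_0=1$).
   Context: For $\sigma\in S_n$, the cyclic permutation $[\sigma]$ is the set of all rotations of $\sigma$; $[S_n]$ is the set of cyclic permutations of length $n$. $[\sigma]$ contains the vincular pattern $[\overline{23}14]$ if some rotation of $\sigma$ has entries $a,b,c,d$ appearing in this order with $a,b$ adjacent and $c<a<b<d$; $\mathrm{Av}_n[\overline{23}14]$ is the set of $[\sigma]\in[S_n]$ not containing it. A set partition of $[i]$ is strongly monotone if, when its blocks are sorted so that their minimum elements are increasing, their maximum elements are also increasing. *)

theory Defs
  imports Main "HOL-Library.Disjoint_Sets"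
begin

definition perms :: "nat \<Rightarrow> nat list set" where
  "perms n = {xs. distinct xs \<and> set xs = {1..n}}"

definition cyc_class :: "nat list \<Rightarrow> nat list set" where
  "cyc_class xs = {rotate k xs | k. k < length xs}"

definition cyclic_perms :: "nat \<Rightarrow> nat list set set" where
  "cyclic_perms n = cyc_class ` perms n"

definition contains_23_1_4 :: "nat list \<Rightarrow> bool" where
  "contains_23_1_4 xs \<longleftrightarrow> (\<exists>p q r. p + 1 < q \<and> q < r \<and> r < length xs \<and>
      xs ! q < xs ! p \<and> xs ! p < xs ! (p + 1) \<and> xs ! (p + 1) < xs ! r)"

definition cyc_contains_23_1_4 :: "nat list set \<Rightarrow> bool" where
  "cyc_contains_23_1_4 C \<longleftrightarrow> (\<exists>xs \<in> C. contains_23_1_4 xs)"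

definition Av_23_1_4 :: "nat \<Rightarrow> nat list set set" where
  "Av_23_1_4 n = {C \<in> cyclic_perms n. \<not> cyc_contains_23_1_4 C}"

definition strongly_monotone :: "nat set set \<Rightarrow> bool" where
  "strongly_monotone P \<longleftrightarrow> (\<forall>B1\<in>P. \<forall>B2\<in>P. Min B1 < Min B2 \<longrightarrow> Max B1 < Max B2)"

definition A_sm :: "nat \<Rightarrow> nat" where
  "A_sm i = card {P. partition_on {1..i} P \<and> strongly_monotone P}"

end

theory Submission
  imports Defs "HOL-Library.Infinite_Set"
begin

text \<open>
  Rotate a cyclic permutation to \<open>1 X n Y\<close>.  An ascent inside \<open>Y\<close> followed by \<open>1\<close> and \<open>n\<close> is
  an occurrence of the pattern, so \<open>Y\<close> decreases and is determined by the set of its entries.  An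
  ascent \<open>a < b\<close> inside \<open>X\<close> can be completed by \<open>n\<close> on one side and by \<open>1\<close> on the other, so every
  later entry of \<open>X\<close> exceeds \<open>a\<close> and every earlier one is below \<open>b\<close>; call such ascents tame.
  Conversely these conditions suffice, so avoiding classes correspond to words with tame ascents
  over an arbitrary subset of \<open>{2..n-1}\<close>.  Cut such a word into its maximal descending runs.  Its
  ascents sit between consecutive runs \<open>D\<close> and \<open>E\<close>, from \<open>last D = Min D\<close> to \<open>hd E = Max E\<close>, and
  they are tame exactly when the minima and the maxima of the runs increase, that is, when the runs
  are the blocks of a strongly monotone partition.
\<close>

section \<open>Adjacent entries of a list\<close>

definition all_adjacent :: "('a list \<Rightarrow> 'a \<Rightarrow> 'a \<Rightarrow> 'a list \<Rightarrow> bool) \<Rightarrow> 'a list \<Rightarrow> bool" where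
  "all_adjacent P xs \<longleftrightarrow> (\<forall>u a b v. xs = u @ a # b # v \<longrightarrow> P u a b v)"

lemma all_adjacentI: "(\<And>u a b v. xs = u @ a # b # v \<Longrightarrow> P u a b v) \<Longrightarrow> all_adjacent P xs"
  by (simp add: all_adjacent_def)

lemma all_adjacentD: "all_adjacent P (u @ a # b # v) \<Longrightarrow> P u a b v"
  by (simp add: all_adjacent_def)

lemma all_adjacent_cong:
  "(\<And>u a b v. xs = u @ a # b # v \<Longrightarrow> P u a b v \<longleftrightarrow> Q u a b v) \<Longrightarrow> all_adjacent P xs \<longleftrightarrow> all_adjacent Q xs"
  by (auto simp: all_adjacent_def)

lemma all_adjacent_Nil [simp]: "all_adjacent P []"
  by (simp add: all_adjacent_def)

lemma all_adjacent_Cons: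
  "all_adjacent P (x # xs) \<longleftrightarrow>
     (xs \<noteq> [] \<longrightarrow> P [] x (hd xs) (tl xs)) \<and> all_adjacent (\<lambda>u. P (x # u)) xs"
  by (cases xs) (auto simp: all_adjacent_def Cons_eq_append_conv)

lemma all_adjacent_append:
  "all_adjacent P (xs @ ys) \<longleftrightarrow>
     all_adjacent (\<lambda>u a b v. P u a b (v @ ys)) xs \<and>
     (xs \<noteq> [] \<longrightarrow> ys \<noteq> [] \<longrightarrow> P (butlast xs) (last xs) (hd ys) (tl ys)) \<and>
     all_adjacent (\<lambda>u. P (xs @ u)) ys"
  by (induction xs arbitrary: P) (auto simp: all_adjacent_Cons)

lemma all_adjacent_map:
  "all_adjacent P (map f xs) \<longleftrightarrow> all_adjacent (\<lambda>u a b v. P (map f u) (f a) (f b) (map f v)) xs"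
  by (induction xs arbitrary: P) (auto simp: all_adjacent_Cons hd_map map_tl)

lemma successively_iff_all_adjacent: "successively R xs \<longleftrightarrow> all_adjacent (\<lambda>_ a b _. R a b) xs"
  by (induction xs) (auto simp: all_adjacent_Cons successively_Cons)

lemma no_ascents_iff_descending:
  fixes xs :: "'a::linorder list"
  assumes "distinct xs"
  shows "all_adjacent (\<lambda>_ a b _. \<not> a < b) xs \<longleftrightarrow> sorted_wrt (>) xs"
proof -
  have "all_adjacent (\<lambda>_ a b _. \<not> a < b) xs \<longleftrightarrow> all_adjacent (\<lambda>_ a b _. a > b) xs"
    using assms by (intro all_adjacent_cong) (auto simp: not_less le_less)
  also have "\<dots> \<longleftrightarrow> sorted_wrt (>) xs"
    by (simp add: successively_iff_all_adjacent[symmetric] successively_conv_sorted_wrt)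
  finally show ?thesis .
qed

lemma all_adjacent_concat:
  assumes "\<And>D. D \<in> set Ds \<Longrightarrow> D \<noteq> [] \<and> successively (\<lambda>a b. \<not> Q a b) D"
  shows "all_adjacent (\<lambda>u a b v. Q a b \<longrightarrow> P u a b v) (concat Ds) \<longleftrightarrow>
    all_adjacent (\<lambda>Us D E Vs. Q (last D) (hd E) \<longrightarrow>
      P (concat Us @ butlast D) (last D) (hd E) (tl E @ concat Vs)) Ds"
  using assms
proof (induction Ds arbitrary: P)
  case (Cons D Ds)
  have "all_adjacent (\<lambda>u a b v. Q a b \<longrightarrow> P u a b (v @ concat Ds)) D"
    using Cons.prems[of D] by (auto simp: successively_iff_all_adjacent all_adjacent_def)
  moreover have "concat Ds \<noteq> [] \<longleftrightarrow> Ds \<noteq> []"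
    "Ds \<noteq> [] \<Longrightarrow> hd (concat Ds) = hd (hd Ds) \<and> tl (concat Ds) = tl (hd Ds) @ concat (tl Ds)"
    using Cons.prems by (cases Ds; force)+
  ultimately show ?case
    using Cons.prems[of D] Cons.IH[of "\<lambda>u. P (D @ u)"] Cons.prems
    by (auto simp: all_adjacent_append all_adjacent_Cons)
qed simp

section \<open>Descending runs\<close>

definition descending_run :: "'a::linorder list \<Rightarrow> bool" where
  "descending_run D \<longleftrightarrow> D \<noteq> [] \<and> sorted_wrt (>) D"

lemma Max_set_descending_run: "descending_run D \<Longrightarrow> Max (set D) = hd D"
  by (cases D) (auto simp: descending_run_def intro!: Max_eqI)

lemma Min_set_descending_run: "descending_run D \<Longrightarrow> Min (set D) = last D"
  by (cases D rule: rev_cases) (auto simp: descending_run_def sorted_wrt_append intro!: Min_eqI)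

lemma descending_run_le_hd: "descending_run D \<Longrightarrow> x \<in> set D \<Longrightarrow> x \<le> hd D"
  by (metis Max_ge Max_set_descending_run List.finite_set)

lemma last_descending_run_le: "descending_run D \<Longrightarrow> x \<in> set D \<Longrightarrow> last D \<le> x"
  by (metis Min_le Min_set_descending_run List.finite_set)

definition descending_list_of_set :: "'a::linorder set \<Rightarrow> 'a list" where
  "descending_list_of_set A = rev (sorted_list_of_set A)"

lemma descending_list_of_set_eq_iff:
  assumes "finite A"
  shows "descending_list_of_set A = xs \<longleftrightarrow> sorted_wrt (>) xs \<and> set xs = A"
proof -
  have "descending_list_of_set A = xs \<longleftrightarrow> sorted_list_of_set A = rev xs"
    by (auto simp: descending_list_of_set_def)
  also have "\<dots> \<longleftrightarrow> sorted_wrt (<) (rev xs) \<and> set (rev xs) = A"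
    using assms by (metis set_sorted_list_of_set strict_sorted_equal strict_sorted_list_of_set)
  finally show ?thesis
    by (simp add: sorted_wrt_rev)
qed

lemma
  assumes "finite A"
  shows sorted_descending_list_of_set: "sorted_wrt (>) (descending_list_of_set A)"
    and set_descending_list_of_set: "set (descending_list_of_set A) = A"
  using descending_list_of_set_eq_iff[OF assms] by blast+

lemma distinct_descending_list_of_set: "distinct (descending_list_of_set A)"
  by (simp add: descending_list_of_set_def)

lemma descending_list_of_set_set: "sorted_wrt (>) xs \<Longrightarrow> descending_list_of_set (set xs) = xs"
  by (simp add: descending_list_of_set_eq_iff)

lemma descending_run_descending_list_of_set:
  assumes "finite A" "A \<noteq> {}"
  shows "descending_run (descending_list_of_set A)"
  using sorted_descending_list_of_set[OF assms(1)] set_descending_list_of_set[OF assms(1)] assms(2)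
  by (auto simp: descending_run_def)

lemma distinct_append_descending_iff:
  assumes "finite A"
  shows "distinct (xs @ ys) \<and> set (xs @ ys) = A \<and> sorted_wrt (>) ys \<longleftrightarrow>
    distinct xs \<and> set xs \<subseteq> A \<and> ys = descending_list_of_set (A - set xs)"
proof -
  have "ys = descending_list_of_set (A - set xs) \<longleftrightarrow> sorted_wrt (>) ys \<and> set ys = A - set xs"
    using assms descending_list_of_set_eq_iff[of "A - set xs" ys] by auto
  moreover have "distinct ys" if "sorted_wrt (>) ys"
    using that by (metis descending_list_of_set_set distinct_descending_list_of_set)
  ultimately show ?thesis
    by auto
qed

fun descending_runs :: "'a::linorder list \<Rightarrow> 'a list list" where
  "descending_runs [] = []"
| "descending_runs (x # xs) = (case descending_runs xs of
     [] \<Rightarrow> [[x]]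
   | D # Ds \<Rightarrow> if hd D < x then (x # D) # Ds else [x] # D # Ds)"

lemma concat_descending_runs [simp]: "concat (descending_runs xs) = xs"
  by (induction xs) (auto split: list.split)

lemma descending_run_descending_runs: "D \<in> set (descending_runs xs) \<Longrightarrow> descending_run D"
proof (induction xs arbitrary: D)
  case (Cons x xs)
  show ?case
  proof (cases "descending_runs xs")
    case Nil
    then show ?thesis
      using Cons.prems by (auto simp: descending_run_def)
  next
    case (Cons E Es)
    then have "descending_run E"
      using Cons.IH by simp
    then have "descending_run (x # E)" if "hd E < x"
      using that descending_run_le_hd[of E] by (fastforce simp: descending_run_def)
    then show ?thesis
      using Cons Cons.prems Cons.IH by (auto simp: descending_run_def split: if_splits)
  qed
qed simp

lemma successively_descending_runs: "successively (\<lambda>D E. last D \<le> hd E) (descending_runs xs)"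
proof (induction xs)
  case (Cons x xs)
  then show ?case
    using descending_run_descending_runs[of _ xs]
    by (auto simp: successively_Cons descending_run_def not_less split: list.split)
qed simp

lemma descending_runs_append:
  assumes "descending_run D" "xs \<noteq> [] \<Longrightarrow> last D \<le> hd xs"
  shows "descending_runs (D @ xs) = D # descending_runs xs"
  using assms
proof (induction D)
  case (Cons x D)
  show ?case
  proof (cases D)
    case Nil
    have "hd E = hd xs" if "descending_runs xs = E # Es" for E Es
    proof -
      have "xs = E @ concat Es"
        by (metis that concat_descending_runs concat.simps(2))
      moreover have "E \<noteq> []"
        using that descending_run_descending_runs[of E xs] by (simp add: descending_run_def)
      ultimately show ?thesis by simp
    qed
    moreover have "xs \<noteq> []" if "descending_runs xs \<noteq> []"
      using that by auto
    ultimately show ?thesis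
      using Nil Cons.prems(2) by (auto simp: not_less split: list.split)
  next
    case (Cons y E)
    then show ?thesis
      using Cons.prems Cons.IH by (auto simp: descending_run_def)
  qed
qed (simp add: descending_run_def)

lemma descending_runs_concat:
  assumes "\<And>D. D \<in> set Ds \<Longrightarrow> descending_run D" "successively (\<lambda>D E. last D \<le> hd E) Ds"
  shows "descending_runs (concat Ds) = Ds"
  using assms
proof (induction Ds)
  case (Cons D Ds)
  have "last D \<le> hd (concat Ds)" if "concat Ds \<noteq> []"
    using that Cons.prems by (cases Ds) (auto simp: descending_run_def)
  moreover have "descending_runs (concat Ds) = Ds"
    using Cons.IH Cons.prems by (auto simp: successively_Cons)
  ultimately show ?case
    using Cons.prems(1) descending_runs_append[of D "concat Ds"] by simp
qed simp

section \<open>Tame ascents\<close>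

definition tame_ascents :: "'a::linorder list \<Rightarrow> bool" where
  "tame_ascents = all_adjacent (\<lambda>u a b v. a < b \<longrightarrow> (\<forall>c\<in>set v. a < c) \<and> (\<forall>d\<in>set u. d < b))"

definition monotone_runs :: "'a::linorder list list \<Rightarrow> bool" where
  "monotone_runs Ds \<longleftrightarrow> (\<forall>D\<in>set Ds. descending_run D) \<and>
     sorted_wrt (\<lambda>D E. hd D < hd E \<and> last D < last E) Ds"

lemma descending_runs_concat_monotone:
  assumes "monotone_runs Ds"
  shows "descending_runs (concat Ds) = Ds"
proof (rule descending_runs_concat)
  have "successively (\<lambda>D E. last D < last E) Ds"
    using assms
    by (intro successively_if_sorted_wrt)
      (auto simp: monotone_runs_def elim: sorted_wrt_mono_rel[rotated])
  then show "successively (\<lambda>D E. last D \<le> hd E) Ds"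
  proof (rule successively_mono)
    fix D E assume "E \<in> set Ds" "last D < last E"
    then show "last D \<le> hd E"
      using assms descending_run_le_hd[of E "last E"]
      by (auto simp: monotone_runs_def descending_run_def)
  qed
qed (use assms in \<open>auto simp: monotone_runs_def\<close>)

lemma tame_ascents_concat_iff:
  assumes "\<forall>D\<in>set Ds. descending_run D"
  shows "tame_ascents (concat Ds) \<longleftrightarrow>
    all_adjacent (\<lambda>Us D E Vs. last D < hd E \<longrightarrow>
      (\<forall>c\<in>set (tl E @ concat Vs). last D < c) \<and> (\<forall>d\<in>set (concat Us @ butlast D). d < hd E)) Ds"
  unfolding tame_ascents_def
proof (rule all_adjacent_concat)
  fix D assume "D \<in> set Ds"
  then show "D \<noteq> [] \<and> successively (\<lambda>a b. \<not> a < b) D"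
    using assms
    by (auto simp: descending_run_def intro: successively_mono[OF successively_if_sorted_wrt])
qed

lemma tame_ascents_consecutive_runs:
  assumes "distinct xs" "tame_ascents xs" and split: "descending_runs xs = Us @ D # E # Vs"
  shows "hd D < hd E \<and> last D < last E"
proof -
  let ?Ds = "Us @ D # E # Vs"
  have runs: "\<forall>F\<in>set ?Ds. descending_run F"
    using descending_run_descending_runs[of _ xs] unfolding split by blast
  have xs: "xs = concat ?Ds"
    using concat_descending_runs[of xs] by (simp only: split)
  have "tame_ascents (concat ?Ds)"
    using assms(2) unfolding xs .
  note tame_junctions = this[unfolded tame_ascents_concat_iff[OF runs]]
  have "last D \<le> hd E"
    using successively_descending_runs[of xs] by (simp add: split successively_append_iff)
  moreover have "last D \<noteq> hd E"
    using assms(1) runs by (cases E; cases D rule: rev_cases) (auto simp: xs descending_run_def)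
  ultimately have "last D < hd E"
    by simp
  moreover from this have "\<forall>c\<in>set (tl E). last D < c" "\<forall>d\<in>set (butlast D). d < hd E"
    using mp[OF all_adjacentD[OF tame_junctions]] unfolding set_append by blast+
  moreover have "last E = hd E \<or> last E \<in> set (tl E)"
    using runs by (cases E) (auto simp: descending_run_def)
  moreover have "hd D = last D \<or> hd D \<in> set (butlast D)"
    using runs by (cases D) (auto simp: descending_run_def)
  ultimately show ?thesis
    by auto
qed

lemma monotone_runs_if_tame_ascents:
  fixes xs :: "'a::linorder list"
  assumes "distinct xs" "tame_ascents xs"
  shows "monotone_runs (descending_runs xs)"
proof -
  let ?R = "\<lambda>D E :: 'a list. hd D < hd E \<and> last D < last E"
  have "successively ?R (descending_runs xs)"
    unfolding successively_iff_all_adjacent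
    using tame_ascents_consecutive_runs[OF assms] by (rule all_adjacentI)
  moreover have "transp ?R"
    by (auto intro: transpI)
  ultimately have "sorted_wrt ?R (descending_runs xs)"
    using successively_conv_sorted_wrt by blast
  then show ?thesis
    by (simp add: monotone_runs_def descending_run_descending_runs)
qed

lemma monotone_runs_last_less:
  assumes "monotone_runs (Us @ D # Vs)" "c \<in> set (concat Vs)"
  shows "last D < c"
proof -
  obtain E where E: "E \<in> set Vs" "c \<in> set E"
    using assms(2) by auto
  then have "last D < last E"
    using assms(1) by (auto simp: monotone_runs_def sorted_wrt_append)
  also have "\<dots> \<le> c"
    using assms(1) E by (auto simp: monotone_runs_def intro: last_descending_run_le)
  finally show ?thesis .
qed

lemma monotone_runs_less_hd:
  assumes "monotone_runs (Us @ D # Vs)" "c \<in> set (concat Us)"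
  shows "c < hd D"
proof -
  obtain E where E: "E \<in> set Us" "c \<in> set E"
    using assms(2) by auto
  then have "c \<le> hd E"
    using assms(1) by (auto simp: monotone_runs_def intro: descending_run_le_hd)
  also have "\<dots> < hd D"
    using assms(1) E(1) by (auto simp: monotone_runs_def sorted_wrt_append)
  finally show ?thesis .
qed

lemma tame_ascents_concat_monotone_runs:
  assumes "monotone_runs Ds"
  shows "tame_ascents (concat Ds)"
proof -
  have "(\<forall>c\<in>set (tl E @ concat Vs). last D < c) \<and> (\<forall>d\<in>set (concat Us @ butlast D). d < hd E)"
    if split: "Ds = Us @ D # E # Vs" for Us D E Vs
  proof -
    have "\<forall>c\<in>set (concat (E # Vs)). last D < c" "\<forall>d\<in>set (concat (Us @ [D])). d < hd E"
      using assms monotone_runs_last_less[of Us D "E # Vs"] monotone_runs_less_hd[of "Us @ [D]" E Vs]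
      unfolding split by simp_all
    moreover have "set (tl E @ concat Vs) \<subseteq> set (concat (E # Vs))"
      "set (concat Us @ butlast D) \<subseteq> set (concat (Us @ [D]))"
      by (cases E) (auto dest: in_set_butlastD)
    ultimately show ?thesis
      by (meson subsetD)
  qed
  moreover have "\<forall>D\<in>set Ds. descending_run D"
    using assms by (simp add: monotone_runs_def)
  ultimately show ?thesis
    by (simp add: tame_ascents_concat_iff all_adjacent_def)
qed

definition tame_words :: "'a::linorder set \<Rightarrow> 'a list set" where
  "tame_words S = {xs. distinct xs \<and> set xs = S \<and> tame_ascents xs}"

lemma finite_tame_words: "finite S \<Longrightarrow> finite (tame_words S)"
  by (rule finite_subset[OF _ finite_subset_distinct[of S]]) (auto simp: tame_words_def)

lemma tame_ascents_map_iff: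
  assumes "strict_mono_on (set xs) f"
  shows "tame_ascents (map f xs) \<longleftrightarrow> tame_ascents xs"
  unfolding tame_ascents_def all_adjacent_map
  by (rule all_adjacent_cong) (auto simp: strict_mono_on_less[OF assms])

lemma bij_betw_map_tame_words:
  assumes mono: "strict_mono_on S f" and bij: "bij_betw f S T"
  shows "bij_betw (map f) (tame_words S) (tame_words T)"
proof -
  have inj: "inj_on f S" and T: "T = f ` S"
    using bij by (auto simp: bij_betw_def)
  have "ys \<in> map f ` tame_words S" if ys: "ys \<in> tame_words T" for ys
  proof -
    have "set ys \<subseteq> f ` S"
      using ys by (simp add: tame_words_def T)
    then obtain xs where xs: "set xs \<subseteq> S" "ys = map f xs"
      by (metis lists_image imageE lists_eq_set mem_Collect_eq)
    have "f ` set xs = f ` S"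
      using ys xs(2) by (simp add: tame_words_def T)
    then have "set xs = S"
      using inj xs(1) by (simp add: inj_on_image_eq_iff)
    then have "xs \<in> tame_words S"
      using ys mono by (simp add: xs(2) tame_words_def distinct_map tame_ascents_map_iff)
    then show ?thesis
      using xs(2) by blast
  qed
  moreover have "map f ` tame_words S \<subseteq> tame_words T"
    using inj mono by (auto simp: T tame_words_def distinct_map tame_ascents_map_iff)
  moreover have "inj_on (map f) (tame_words S)"
    by (rule inj_onI) (use inj in \<open>auto simp: tame_words_def dest: map_inj_on\<close>)
  ultimately show ?thesis
    by (auto simp: bij_betw_def)
qed

lemma card_tame_words_cong:
  fixes S T :: "nat set"
  assumes "finite S" "finite T" "card S = card T"
  shows "card (tame_words S) = card (tame_words T)"
proof -
  have "card (tame_words {..<card U}) = card (tame_words U)" if "finite U" for U :: "nat set"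
    using ex_bij_betw_strict_mono_card[OF that] bij_betw_map_tame_words bij_betw_same_card by metis
  then show ?thesis
    using assms by metis
qed

section \<open>Strongly monotone partitions\<close>

definition strongly_monotone_partitions :: "nat set \<Rightarrow> nat set set set" where
  "strongly_monotone_partitions S = {P. partition_on S P \<and> strongly_monotone P}"

lemma strongly_monotone_set_iff:
  assumes "sorted_wrt (\<lambda>B C. Min B < Min C) Bs"
  shows "strongly_monotone (set Bs) \<longleftrightarrow> sorted_wrt (\<lambda>B C. Max B < Max C) Bs"
  using assms by (induction Bs) (fastforce simp: strongly_monotone_def)+

lemma monotone_runs_iff:
  "monotone_runs Ds \<longleftrightarrow> (\<forall>D\<in>set Ds. descending_run D) \<and>
     sorted_wrt (\<lambda>B C. Max B < Max C) (map set Ds) \<and> sorted_wrt (\<lambda>B C. Min B < Min C) (map set Ds)"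
  by (induction Ds)
    (auto simp: monotone_runs_def Max_set_descending_run Min_set_descending_run)

abbreviation blocks :: "'a list list \<Rightarrow> 'a set set" where
  "blocks Ds \<equiv> set ` set Ds"

lemma partition_on_concat:
  assumes "distinct (concat Ds)" "[] \<notin> set Ds"
  shows "partition_on (set (concat Ds)) (blocks Ds)"
proof (rule partition_onI)
  fix B C assume "B \<in> blocks Ds" "C \<in> blocks Ds" "B \<noteq> C"
  then show "disjnt B C"
    using assms(1) by (auto simp: distinct_concat_iff disjnt_def)
qed (use assms(2) in auto)

lemma (in linorder) sorted_key_list_of_set_eq_iff:
  assumes "inj_on f A" "finite A"
  shows "sorted_key_list_of_set f A = xs \<longleftrightarrow> sorted_wrt (<) (map f xs) \<and> set xs = A"
proof -
  interpret folding_insort_key "(\<le>)" "(<)" A f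
    by unfold_locales fact
  have "length xs = card A" if "sorted_wrt (<) (map f xs)" "set xs = A"
    using that by (metis strict_sorted_iff distinct_card distinct_map)
  then show ?thesis
    using sorted_key_list_of_set_unique[OF subset_refl assms(2), of xs] by auto
qed

lemma strongly_monotone_partition_of_monotone_runs:
  assumes "monotone_runs Ds" "distinct (concat Ds)"
  shows "blocks Ds \<in> strongly_monotone_partitions (set (concat Ds))"
proof -
  have "[] \<notin> set Ds"
    using assms(1) by (auto simp: monotone_runs_def descending_run_def)
  moreover have "strongly_monotone (set (map set Ds))"
    using assms(1) unfolding monotone_runs_iff by (simp add: strongly_monotone_set_iff del: set_map)
  ultimately show ?thesis
    using partition_on_concat[OF assms(2)] by (simp add: strongly_monotone_partitions_def)
qed

definition runs_of_partition :: "nat set set \<Rightarrow> nat list list" where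
  "runs_of_partition P = map descending_list_of_set (sorted_key_list_of_set Min P)"

lemma runs_of_partition_blocks:
  assumes "monotone_runs Ds"
  shows "runs_of_partition (blocks Ds) = Ds"
proof -
  have runs: "\<forall>D\<in>set Ds. sorted_wrt (>) D"
    and mins: "sorted_wrt (<) (map Min (map set Ds))"
    using assms by (auto simp: monotone_runs_iff descending_run_def sorted_wrt_map)
  have "inj_on Min (set (map set Ds))"
    using mins by (simp only: strict_sorted_iff distinct_map)
  then have "sorted_key_list_of_set Min (set (map set Ds)) = map set Ds"
    using mins by (subst sorted_key_list_of_set_eq_iff) auto
  then show ?thesis
    using runs by (simp add: runs_of_partition_def descending_list_of_set_set map_idI)
qed

lemma
  assumes "finite S" "P \<in> strongly_monotone_partitions S"
  shows monotone_runs_of_partition: "monotone_runs (runs_of_partition P)"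
    and distinct_runs_of_partition: "distinct (concat (runs_of_partition P))"
    and blocks_runs_of_partition: "blocks (runs_of_partition P) = P"
proof -
  have P: "partition_on S P" "strongly_monotone P"
    using assms(2) by (simp_all add: strongly_monotone_partitions_def)
  have block: "finite B" "B \<noteq> {}" if "B \<in> P" for B
    using that P(1) assms(1) by (auto simp: partition_on_def intro: finite_subset)
  have "inj_on Min P"
    using partition_onD2[OF P(1)] block by (intro inj_onI) (metis Min_in disjointD disjoint_iff)
  moreover define Bs where "Bs = sorted_key_list_of_set Min P"
  ultimately have mins: "sorted_wrt (<) (map Min Bs)" and set_Bs: "set Bs = P"
    using sorted_key_list_of_set_eq_iff[of Min P Bs] finite_elements[OF assms(1) P(1)] by auto
  have runs_eq: "runs_of_partition P = map descending_list_of_set Bs"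
    by (simp add: runs_of_partition_def Bs_def)
  have sets: "map set (runs_of_partition P) = Bs"
    using block by (auto simp: runs_eq set_Bs set_descending_list_of_set intro!: map_idI)
  show blocks: "blocks (runs_of_partition P) = P"
    using arg_cong[OF sets, of set] by (simp add: set_Bs)
  have run: "descending_run D" if "D \<in> set (runs_of_partition P)" for D
    using that block by (auto simp: runs_eq set_Bs intro: descending_run_descending_list_of_set)
  have "sorted_wrt (\<lambda>B C. Min B < Min C) Bs"
    using mins by (simp add: sorted_wrt_map)
  then show "monotone_runs (runs_of_partition P)"
    unfolding monotone_runs_iff sets
    using P(2) run strongly_monotone_set_iff[of Bs] by (simp add: set_Bs)
  show "distinct (concat (runs_of_partition P))"
  proof (rule distinct_concat)
    have inj_set: "distinct (map set (runs_of_partition P))"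
      using mins unfolding sets by (metis strict_sorted_iff distinct_map)
    then show "distinct (runs_of_partition P)"
      by (simp add: distinct_map)
    fix D E assume "D \<in> set (runs_of_partition P)" "E \<in> set (runs_of_partition P)" "D \<noteq> E"
    moreover from this have "set D \<noteq> set E"
      using inj_set by (auto simp: distinct_map dest: inj_onD)
    ultimately show "set D \<inter> set E = {}"
      using partition_onD2[OF P(1)] blocks by (blast dest: disjointD)
  qed (auto simp: runs_eq distinct_descending_list_of_set)
qed

lemma bij_betw_blocks_descending_runs:
  assumes "finite S"
  shows "bij_betw (\<lambda>xs. blocks (descending_runs xs)) (tame_words S) (strongly_monotone_partitions S)"
proof (rule bij_betw_byWitness[where f' = "\<lambda>P. concat (runs_of_partition P)"])
  show "\<forall>xs\<in>tame_words S. concat (runs_of_partition (blocks (descending_runs xs))) = xs"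
    by (simp add: tame_words_def runs_of_partition_blocks monotone_runs_if_tame_ascents)
  show "\<forall>P\<in>strongly_monotone_partitions S.
      blocks (descending_runs (concat (runs_of_partition P))) = P"
    using assms descending_runs_concat_monotone monotone_runs_of_partition blocks_runs_of_partition
    by metis
  have "blocks (descending_runs xs) \<in> strongly_monotone_partitions S" if "xs \<in> tame_words S" for xs
    using that strongly_monotone_partition_of_monotone_runs[of "descending_runs xs"]
      monotone_runs_if_tame_ascents[of xs]
    by (auto simp only: tame_words_def mem_Collect_eq concat_descending_runs)
  then show "(\<lambda>xs. blocks (descending_runs xs)) ` tame_words S \<subseteq> strongly_monotone_partitions S"
    by blast
  have "concat (runs_of_partition P) \<in> tame_words S" if P: "P \<in> strongly_monotone_partitions S" for P
  proof -
    have "set (concat (runs_of_partition P)) = \<Union>P"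
      using arg_cong[OF blocks_runs_of_partition[OF assms P], of Union] by simp
    then show ?thesis
      using P monotone_runs_of_partition[OF assms P] distinct_runs_of_partition[OF assms P]
      by (auto simp: tame_words_def strongly_monotone_partitions_def partition_on_def
          intro: tame_ascents_concat_monotone_runs)
  qed
  then show "(\<lambda>P. concat (runs_of_partition P)) ` strongly_monotone_partitions S \<subseteq> tame_words S"
    by auto
qed

lemma card_tame_words:
  fixes S :: "nat set"
  assumes "finite S"
  shows "card (tame_words S) = A_sm (card S)"
proof -
  have "card (tame_words S) = card (tame_words {1..card S})"
    by (rule card_tame_words_cong) (use assms in auto)
  also have "\<dots> = A_sm (card S)"
    using bij_betw_same_card[OF bij_betw_blocks_descending_runs[OF finite_atLeastAtMost]]
    by (simp add: A_sm_def strongly_monotone_partitions_def)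
  finally show ?thesis .
qed

section \<open>Cyclic pattern avoidance\<close>

lemma cyc_class_eq_range:
  assumes "xs \<noteq> []"
  shows "cyc_class xs = range (\<lambda>k. rotate k xs)"
proof -
  have "rotate k xs \<in> cyc_class xs" for k
    using assms unfolding cyc_class_def
    by (auto intro!: exI[of _ "k mod length xs"] simp: rotate_conv_mod[of k])
  then show ?thesis
    by (auto simp: cyc_class_def)
qed

lemma cyc_class_iff:
  assumes "xs \<noteq> []"
  shows "ys \<in> cyc_class xs \<longleftrightarrow> (\<exists>u v. xs = u @ v \<and> ys = v @ u)"
proof
  assume "ys \<in> cyc_class xs"
  then show "\<exists>u v. xs = u @ v \<and> ys = v @ u"
    using assms by (metis append_take_drop_id cyc_class_eq_range imageE rotate_drop_take)
next
  assume "\<exists>u v. xs = u @ v \<and> ys = v @ u"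
  then show "ys \<in> cyc_class xs"
    using assms by (metis cyc_class_eq_range rangeI rotate_append)
qed

lemma self_in_cyc_class: "xs \<noteq> [] \<Longrightarrow> xs \<in> cyc_class xs"
  by (auto simp: cyc_class_iff)

lemma cyc_class_append_commute: "cyc_class (v @ u) = cyc_class (u @ v)"
proof (cases "u @ v = []")
  case False
  have "cyc_class (v @ u) \<subseteq> cyc_class (u @ v)" if nonempty: "u @ v \<noteq> []" for u v
  proof
    fix ys assume "ys \<in> cyc_class (v @ u)"
    then obtain p q where "v @ u = p @ q" and ys: "ys = q @ p"
      using nonempty by (auto simp: cyc_class_iff)
    then consider t where "v = p @ t" "q = t @ u" | t where "p = v @ t" "u = t @ q"
      by (auto simp: append_eq_append_conv2)
    then show "ys \<in> cyc_class (u @ v)"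
    proof cases
      case 1
      then have "u @ v = (u @ p) @ t" "ys = t @ (u @ p)"
        by (simp_all add: ys)
      then show ?thesis
        using cyc_class_iff[OF nonempty] by blast
    next
      case 2
      then have "u @ v = t @ (q @ v)" "ys = (q @ v) @ t"
        by (simp_all add: ys)
      then show ?thesis
        using cyc_class_iff[OF nonempty] by blast
    qed
  qed
  then show ?thesis
    using False by fastforce
qed auto

lemma cyc_class_eqI:
  assumes "ys \<in> cyc_class xs"
  shows "cyc_class ys = cyc_class xs"
proof -
  have "xs \<noteq> []"
    using assms by (auto simp: cyc_class_def)
  then show ?thesis
    using assms cyc_class_append_commute by (auto simp: cyc_class_iff)
qed

lemma cyc_class_Cons_inject:
  assumes "distinct (x # xs)" "cyc_class (x # xs) = cyc_class (x # ys)"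
  shows "xs = ys"
proof -
  have "x # ys \<in> cyc_class (x # xs)"
    using assms(2) self_in_cyc_class[of "x # ys"] by simp
  then obtain u v where uv: "x # xs = u @ v" "x # ys = v @ u"
    by (auto simp: cyc_class_iff)
  moreover have "u = [] \<or> v = []"
  proof (rule ccontr)
    assume "\<not> ?thesis"
    then have "x \<in> set u" "x \<in> set v"
      using uv by (auto simp: Cons_eq_append_conv)
    then show False
      using assms(1) uv(1) by (metis distinct_append disjoint_iff)
  qed
  ultimately show ?thesis by auto
qed

text \<open>The entries \<open>a < b\<close> play the roles of 2 and 3 in the pattern.\<close>

abbreviation avoids_14_outside :: "'a::linorder \<Rightarrow> 'a \<Rightarrow> 'a list \<Rightarrow> bool" where
  "avoids_14_outside a b \<equiv> sorted_wrt (\<lambda>c d. \<not> (c < a \<and> b < d))"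

lemma avoids_14_outsideI:
  "(\<forall>c\<in>set xs. a \<le> c) \<or> (\<forall>d\<in>set xs. d \<le> b) \<Longrightarrow> avoids_14_outside a b xs"
  by (induction xs) (auto simp: not_less)

lemma avoids_23_1_4_iff:
  "\<not> contains_23_1_4 xs \<longleftrightarrow> all_adjacent (\<lambda>u a b v. a < b \<longrightarrow> avoids_14_outside a b v) xs"
proof
  assume avoids: "\<not> contains_23_1_4 xs"
  show "all_adjacent (\<lambda>u a b v. a < b \<longrightarrow> avoids_14_outside a b v) xs"
  proof (intro all_adjacentI impI)
    fix u a b v assume xs: "xs = u @ a # b # v" and "a < b"
    show "avoids_14_outside a b v"
      unfolding sorted_wrt_iff_nth_less
    proof (intro allI impI notI)
      fix i j assume "i < j" "j < length v" "v ! i < a \<and> b < v ! j"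
      then have "contains_23_1_4 xs"
        unfolding contains_23_1_4_def xs using \<open>a < b\<close>
        by (intro exI[of _ "length u"] exI[of _ "length u + 2 + i"] exI[of _ "length u + 2 + j"])
          (auto simp: nth_append)
      then show False
        using avoids by contradiction
    qed
  qed
next
  assume free: "all_adjacent (\<lambda>u a b v. a < b \<longrightarrow> avoids_14_outside a b v) xs"
  show "\<not> contains_23_1_4 xs"
  proof
    assume "contains_23_1_4 xs"
    then obtain p q r where pqr: "p + 1 < q" "q < r" "r < length xs"
      "xs ! q < xs ! p" "xs ! p < xs ! (p + 1)" "xs ! (p + 1) < xs ! r"
      unfolding contains_23_1_4_def by blast
    define v where "v = drop (p + 2) xs"
    have "drop p xs = xs ! p # xs ! (p + 1) # v"
      using pqr by (simp add: v_def Cons_nth_drop_Suc[symmetric])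
    then have "xs = take p xs @ xs ! p # xs ! (p + 1) # v"
      using append_take_drop_id[of p xs] by simp
    then have "avoids_14_outside (xs ! p) (xs ! (p + 1)) v"
      using free pqr(5) unfolding all_adjacent_def by blast
    moreover have "v ! (q - (p + 2)) = xs ! q" "v ! (r - (p + 2)) = xs ! r"
      "q - (p + 2) < r - (p + 2)" "r - (p + 2) < length v"
      using pqr by (auto simp: v_def simp del: add_2_eq_Suc')
    ultimately show False
      using pqr by (metis (no_types, lifting) sorted_wrt_iff_nth_less)
  qed
qed

lemma cyc_avoids_iff:
  assumes "xs \<noteq> []"
  shows "\<not> cyc_contains_23_1_4 (cyc_class xs) \<longleftrightarrow>
    (\<forall>a b ys. a # b # ys \<in> cyc_class xs \<longrightarrow> a < b \<longrightarrow> avoids_14_outside a b ys)"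
    (is "_ \<longleftrightarrow> ?R")
proof
  assume "\<not> cyc_contains_23_1_4 (cyc_class xs)"
  then show ?R
    using avoids_23_1_4_iff all_adjacentD[of _ "[]"]
    by (fastforce simp: cyc_contains_23_1_4_def)
next
  assume rotations_avoid: ?R
  have "avoids_14_outside a b v" if "u @ a # b # v \<in> cyc_class xs" "a < b" for u a b v
  proof -
    have "a # b # v @ u \<in> cyc_class (u @ a # b # v)"
      using self_in_cyc_class[of "a # b # v @ u"] cyc_class_append_commute[of "a # b # v" u] by simp
    then have "a # b # v @ u \<in> cyc_class xs"
      using cyc_class_eqI[OF that(1)] by simp
    then have "avoids_14_outside a b (v @ u)"
      using rotations_avoid that(2) by blast
    then show ?thesis
      by (simp add: sorted_wrt_append)
  qed
  then show "\<not> cyc_contains_23_1_4 (cyc_class xs)"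
    by (auto simp: cyc_contains_23_1_4_def avoids_23_1_4_iff all_adjacent_def)
qed

lemma ascent_in_cyc_class_Cons_Min_iff:
  assumes min: "\<forall>y\<in>set xs. x < y" and "a < b" "a \<noteq> x"
  shows "a # b # ys \<in> cyc_class (x # xs) \<longleftrightarrow> (\<exists>u v. xs = u @ a # b # v \<and> ys = v @ x # u)"
proof
  assume "a # b # ys \<in> cyc_class (x # xs)"
  then obtain u v where uv: "x # xs = u @ v" "a # b # ys = v @ u"
    by (auto simp: cyc_class_iff)
  then have "u \<noteq> []" "v \<noteq> []"
    using \<open>a \<noteq> x\<close> by auto
  then obtain u' v' where split: "u = x # u'" "v = a # v'"
    using uv by (auto simp: neq_Nil_conv)
  have "b \<noteq> x"
    using min uv(1) split \<open>a < b\<close> by auto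
  then obtain v'' where "v' = b # v''" "ys = v'' @ x # u'"
    using uv(2) split by (cases v') auto
  then show "\<exists>u v. xs = u @ a # b # v \<and> ys = v @ x # u"
    using uv(1) split by auto
next
  assume "\<exists>u v. xs = u @ a # b # v \<and> ys = v @ x # u"
  then obtain u v where "xs = u @ a # b # v" "ys = v @ x # u"
    by blast
  then have "x # xs = (x # u) @ (a # b # v)" "a # b # ys = (a # b # v) @ (x # u)"
    by simp_all
  then show "a # b # ys \<in> cyc_class (x # xs)"
    unfolding cyc_class_iff[OF list.distinct(2)] by blast
qed

lemma cyc_avoids_Cons_Min_iff:
  assumes min: "\<forall>y\<in>set xs. x < y"
  shows "\<not> cyc_contains_23_1_4 (cyc_class (x # xs)) \<longleftrightarrow>
    all_adjacent (\<lambda>u a b v. a < b \<longrightarrow> avoids_14_outside a b v \<and> (\<forall>d\<in>set u. d \<le> b)) xs"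
    (is "_ \<longleftrightarrow> ?R")
proof -
  have "avoids_14_outside x b ys" if rotation: "x # b # ys \<in> cyc_class (x # xs)" for b ys
  proof (rule avoids_14_outsideI)
    obtain u v where "x # xs = u @ v" "x # b # ys = v @ u"
      using rotation by (auto simp: cyc_class_iff)
    then have "set (x # b # ys) = set (x # xs)"
      by (metis set_append sup_commute)
    then have "set ys \<subseteq> insert x (set xs)"
      by auto
    then show "(\<forall>c\<in>set ys. x \<le> c) \<or> (\<forall>d\<in>set ys. d \<le> b)"
      using min by (auto intro: less_imp_le)
  qed
  then have "\<not> cyc_contains_23_1_4 (cyc_class (x # xs)) \<longleftrightarrow>
      (\<forall>a b ys. a < b \<longrightarrow> a \<noteq> x \<longrightarrow> a # b # ys \<in> cyc_class (x # xs) \<longrightarrow> avoids_14_outside a b ys)"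
    unfolding cyc_avoids_iff[OF list.distinct(2)] by blast
  also have "\<dots> \<longleftrightarrow> all_adjacent (\<lambda>u a b v. a < b \<longrightarrow> a \<noteq> x \<longrightarrow> avoids_14_outside a b (v @ x # u)) xs"
    by (simp add: all_adjacent_def ascent_in_cyc_class_Cons_Min_iff[OF min]) blast
  also have "\<dots> \<longleftrightarrow> ?R"
  proof (rule all_adjacent_cong)
    fix u a b v assume xs: "xs = u @ a # b # v"
    show "(a < b \<longrightarrow> a \<noteq> x \<longrightarrow> avoids_14_outside a b (v @ x # u)) \<longleftrightarrow>
        (a < b \<longrightarrow> avoids_14_outside a b v \<and> (\<forall>d\<in>set u. d \<le> b))"
      using min avoids_14_outsideI[of u a b] by (force simp: xs sorted_wrt_append)
  qed
  finally show ?thesis .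
qed

lemma avoids_14_outside_append_Max_iff:
  assumes "a < b" "b < n" "a \<notin> set v" "sorted_wrt (>) Y"
  shows "avoids_14_outside a b (v @ n # Y) \<longleftrightarrow> (\<forall>c\<in>set v. a < c)"
proof
  assume "avoids_14_outside a b (v @ n # Y)"
  then have "\<forall>c\<in>set v. \<not> c < a"
    using assms(2) by (simp add: sorted_wrt_append)
  then show "\<forall>c\<in>set v. a < c"
    using assms(3) by (metis linorder_less_linear)
next
  assume above: "\<forall>c\<in>set v. a < c"
  then have "avoids_14_outside a b v"
    by (intro avoids_14_outsideI) (auto intro: less_imp_le)
  moreover have "avoids_14_outside a b Y"
    using assms(1,4) by (auto elim!: sorted_wrt_mono_rel[rotated])
  ultimately show "avoids_14_outside a b (v @ n # Y)"
    using above assms(1,2) by (auto simp: sorted_wrt_append)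
qed

lemma cyc_avoids_Min_Max_iff:
  assumes dist: "distinct (X @ Y)" and "m < n" and bounds: "\<forall>x\<in>set X \<union> set Y. m < x \<and> x < n"
  shows "\<not> cyc_contains_23_1_4 (cyc_class (m # X @ n # Y)) \<longleftrightarrow> tame_ascents X \<and> sorted_wrt (>) Y"
proof -
  let ?P = "\<lambda>u a b v. a < b \<longrightarrow> avoids_14_outside a b v \<and> (\<forall>d\<in>set u. d \<le> b)"
  have "all_adjacent ?P (X @ n # Y) \<longleftrightarrow>
      all_adjacent (\<lambda>u a b v. ?P u a b (v @ n # Y)) X \<and> all_adjacent (\<lambda>u. ?P (X @ n # u)) Y"
  proof -
    have "avoids_14_outside (last X) n Y"
      using bounds by (intro avoids_14_outsideI) (auto intro: less_imp_le)
    moreover have "\<forall>d\<in>set (butlast X). d \<le> n" "Y \<noteq> [] \<Longrightarrow> hd Y < n"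
      using bounds by (auto dest!: in_set_butlastD intro!: less_imp_le)
    ultimately show ?thesis
      by (auto simp: all_adjacent_append all_adjacent_Cons)
  qed
  moreover have "all_adjacent (\<lambda>u. ?P (X @ n # u)) Y \<longleftrightarrow> sorted_wrt (>) Y"
  proof -
    have "all_adjacent (\<lambda>u. ?P (X @ n # u)) Y \<longleftrightarrow> all_adjacent (\<lambda>_ a b _. \<not> a < b) Y"
      using bounds by (intro all_adjacent_cong) force
    then show ?thesis
      using dist by (simp add: no_ascents_iff_descending)
  qed
  moreover have "all_adjacent (\<lambda>u a b v. ?P u a b (v @ n # Y)) X \<longleftrightarrow> tame_ascents X"
    if Y: "sorted_wrt (>) Y"
    unfolding tame_ascents_def
  proof (rule all_adjacent_cong)
    fix u a b v assume X: "X = u @ a # b # v"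
    have "b < n" "a \<notin> set v" "b \<notin> set u"
      using bounds dist by (auto simp: X)
    moreover from this have "a < b \<Longrightarrow> avoids_14_outside a b (v @ n # Y) \<longleftrightarrow> (\<forall>c\<in>set v. a < c)"
      using Y by (intro avoids_14_outside_append_Max_iff)
    ultimately show "?P u a b (v @ n # Y) \<longleftrightarrow> (a < b \<longrightarrow> (\<forall>c\<in>set v. a < c) \<and> (\<forall>d\<in>set u. d < b))"
      by (auto simp: le_less)
  qed
  moreover have "\<forall>x\<in>set (X @ n # Y). m < x"
    using assms(2) bounds by auto
  ultimately show ?thesis
    using cyc_avoids_Cons_Min_iff[of "X @ n # Y" m] by blast
qed

section \<open>Counting\<close>

lemma Cons_in_perms_iff:
  assumes "n \<ge> 2"
  shows "1 # X @ n # Y \<in> perms n \<longleftrightarrow> distinct (X @ Y) \<and> set (X @ Y) = {2..n-1}"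
proof -
  have ends: "{1..n} = insert 1 (insert n {2..n-1})" "1 \<notin> {2..n-1}" "n \<notin> {2..n-1}" "1 \<noteq> n"
    using assms by auto
  let ?S = "set (X @ Y)"
  have "1 # X @ n # Y \<in> perms n \<longleftrightarrow> distinct (X @ Y) \<and> 1 \<notin> ?S \<and> n \<notin> ?S \<and>
      insert 1 (insert n ?S) = insert 1 (insert n {2..n-1})"
    unfolding perms_def ends(1) using ends(4) by auto
  also have "\<dots> \<longleftrightarrow> distinct (X @ Y) \<and> ?S = {2..n-1}"
    using ends(2-4) by (metis insert_iff insert_ident)
  finally show ?thesis .
qed

lemma cyclic_perms_eq:
  assumes "n \<ge> 2"
  shows "cyclic_perms n = {cyc_class (1 # X @ n # Y) | X Y. distinct (X @ Y) \<and> set (X @ Y) = {2..n-1}}"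
    (is "_ = ?N")
proof (intro equalityI subsetI)
  fix C assume "C \<in> cyclic_perms n"
  then obtain xs where xs: "xs \<in> perms n" and C: "C = cyc_class xs"
    by (auto simp: cyclic_perms_def)
  then obtain u v where split: "xs = u @ 1 # v"
    using assms split_list[of 1 xs] by (auto simp: perms_def)
  have "n \<in> set (v @ u)"
  proof -
    have "n \<in> set xs" "n \<noteq> 1"
      using xs assms by (auto simp: perms_def)
    then show ?thesis
      by (auto simp: split)
  qed
  then obtain X Y where XY: "v @ u = X @ n # Y"
    using split_list by metis
  have "C = cyc_class (1 # X @ n # Y)"
    using C split XY cyc_class_append_commute[of "1 # v" u] by simp
  moreover have "1 # X @ n # Y \<in> perms n"
    using xs unfolding XY[symmetric] by (auto simp: perms_def split)
  ultimately show "C \<in> ?N"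
    using Cons_in_perms_iff[OF assms] by blast
next
  fix C assume "C \<in> ?N"
  then show "C \<in> cyclic_perms n"
    using Cons_in_perms_iff[OF assms] unfolding cyclic_perms_def by blast
qed

definition tame_subwords :: "'a::linorder set \<Rightarrow> 'a list set" where
  "tame_subwords S = {xs. distinct xs \<and> set xs \<subseteq> S \<and> tame_ascents xs}"

definition normal_form :: "nat \<Rightarrow> nat list \<Rightarrow> nat list" where
  "normal_form n X = 1 # X @ n # descending_list_of_set ({2..n-1} - set X)"

lemma Av_23_1_4_eq_image_normal_form:
  assumes "n \<ge> 2"
  shows "Av_23_1_4 n = (\<lambda>X. cyc_class (normal_form n X)) ` tame_subwords {2..n-1}"
proof -
  have avoids: "\<not> cyc_contains_23_1_4 (cyc_class (1 # X @ n # Y)) \<longleftrightarrow> tame_ascents X \<and> sorted_wrt (>) Y"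
    if "distinct (X @ Y)" "set (X @ Y) = {2..n-1}" for X Y
  proof (rule cyc_avoids_Min_Max_iff)
    show "\<forall>x\<in>set X \<union> set Y. 1 < x \<and> x < n"
      using that(2) assms by auto
  qed (use that assms in auto)
  have "Av_23_1_4 n = {cyc_class (1 # X @ n # Y) | X Y.
      distinct (X @ Y) \<and> set (X @ Y) = {2..n-1} \<and> tame_ascents X \<and> sorted_wrt (>) Y}"
    unfolding Av_23_1_4_def cyclic_perms_eq[OF assms] using avoids by blast
  also have "\<dots> = {cyc_class (1 # X @ n # Y) | X Y.
      X \<in> tame_subwords {2..n-1} \<and> Y = descending_list_of_set ({2..n-1} - set X)}"
    using distinct_append_descending_iff[of "{2..n-1}"] unfolding tame_subwords_def by blast
  finally show ?thesis
    unfolding normal_form_def by blast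
qed

lemma inj_on_cyc_class_normal_form:
  assumes "n \<ge> 2"
  shows "inj_on (\<lambda>X. cyc_class (normal_form n X)) (tame_subwords {2..n-1})"
proof (rule inj_onI)
  fix X X' assume "X \<in> tame_subwords {2..n-1}"
    and eq: "cyc_class (normal_form n X) = cyc_class (normal_form n X')"
  then have X: "distinct X" "set X \<subseteq> {2..n-1}"
    by (simp_all add: tame_subwords_def)
  let ?Y = "\<lambda>X. descending_list_of_set ({2..n-1} - set X)"
  have Y: "distinct (X @ ?Y X) \<and> set (X @ ?Y X) = {2..n-1}"
    using X distinct_append_descending_iff[of "{2..n-1}" X "?Y X"] by blast
  then have "normal_form n X \<in> perms n"
    unfolding normal_form_def Cons_in_perms_iff[OF assms] .
  then have "distinct (1 # X @ n # ?Y X)"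
    by (simp add: perms_def normal_form_def)
  then have "X @ n # ?Y X = X' @ n # ?Y X'"
    using eq unfolding normal_form_def by (rule cyc_class_Cons_inject)
  moreover have "n \<notin> {2..n-1}"
    using assms by simp
  then have "n \<notin> set X" "n \<notin> set (?Y X)"
    using Y by auto
  ultimately show "X = X'"
    using append_Cons_eq_iff by metis
qed

lemma sum_Pow_card:
  fixes f :: "nat \<Rightarrow> 'a::comm_semiring_1"
  assumes "finite A"
  shows "(\<Sum>T\<in>Pow A. f (card T)) = (\<Sum>i = 0..card A. of_nat (card A choose i) * f i)"
proof -
  have "(\<Sum>T\<in>Pow A. f (card T)) = (\<Sum>i\<in>{0..card A}. \<Sum>T | T \<in> Pow A \<and> card T = i. f (card T))"
    using assms by (intro sum.group[symmetric]) (auto intro: card_mono)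
  also have "\<dots> = (\<Sum>i = 0..card A. of_nat (card A choose i) * f i)"
    using assms by (intro sum.cong) (auto simp: n_subsets)
  finally show ?thesis .
qed

lemma card_tame_subwords:
  fixes S :: "nat set"
  assumes "finite S"
  shows "card (tame_subwords S) = (\<Sum>i = 0..card S. (card S choose i) * A_sm i)"
proof -
  have "tame_subwords S = (\<Union>T\<in>Pow S. tame_words T)"
    by (auto simp: tame_subwords_def tame_words_def)
  also have "card \<dots> = (\<Sum>T\<in>Pow S. card (tame_words T))"
  proof (rule card_UN_disjoint)
    show "\<forall>T\<in>Pow S. finite (tame_words T)"
      using assms by (auto intro: finite_tame_words finite_subset)
  qed (use assms in \<open>auto simp: tame_words_def\<close>)
  also have "\<dots> = (\<Sum>T\<in>Pow S. A_sm (card T))"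
    using assms by (intro sum.cong refl card_tame_words) (auto intro: finite_subset)
  also have "\<dots> = (\<Sum>i = 0..card S. (card S choose i) * A_sm i)"
    using sum_Pow_card[OF assms, of A_sm] by simp
  finally show ?thesis .
qed

theorem theorem5p12:
  fixes n :: nat
  assumes "n \<ge> 2"
  shows "card (Av_23_1_4 n) = (\<Sum>i = 0..n-2. (n - 2 choose i) * A_sm i)"
proof -
  have "card (Av_23_1_4 n) = card (tame_subwords {2..n-1})"
    unfolding Av_23_1_4_eq_image_normal_form[OF assms]
    by (rule card_image[OF inj_on_cyc_class_normal_form[OF assms]])
  also have "\<dots> = (\<Sum>i = 0..card {2..n-1}. (card {2..n-1} choose i) * A_sm i)"
    by (rule card_tame_subwords) simp
  also have "card {2..n-1} = n - 2"
    using assms by simp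
  finally show ?thesis .
qed

end
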